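(* Let $A$ and $B$ be nonempty finite subsets of an abelian group $G$, with $|A| = |B|$ and $1 \notin B$. Let $0 \leq d \leq |A|$ be an integer. Then there exists a partial matching of $(A,B)$ with defect $d$ if and only if, for every pair of subsets $S \subseteq A$ and $R \subseteq B \cup \{1\}$ with $SR = S$, we have $$|S| - d \leq |B \setminus R|.$$
   Context: The group $G$ is written multiplicatively with identity $1$. For subsets $S,T \subseteq G$, $ST = \{st : s \in S,\ t \in T\}$ (so $ST = \emptyset$ if $S$ or $T$ is empty). For nonempty finite $A,B \subseteq G$ with $|A|=|B|$, a partial matching of $(A,B)$ with defect $d$ is an injective map $f : A' \to B$, where $A' \subseteq A$ and $|A \setminus A'| = d$, such that $a f(a) \notin A$ for all $a \in A'$. The empty map (with $A' = \emptyset$) is allowed. *)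

theory Defs
  imports "HOL-Algebra.Coset"
begin

(* A partial map from A to B is given by its domain A' and a total function f,
   of which only the values on A' matter. The ambient conditions (A and B are
   nonempty finite subsets of the carrier with card A = card B) are left to the
   theorems. *)
definition partial_matching ::
  "('a, 'b) monoid_scheme \<Rightarrow> 'a set \<Rightarrow> 'a set \<Rightarrow> nat \<Rightarrow> 'a set \<Rightarrow> ('a \<Rightarrow> 'a) \<Rightarrow> bool"
where
  "partial_matching G A B d A' f \<longleftrightarrow>
     A' \<subseteq> A \<and> card (A - A') = d \<and> inj_on f A' \<and> f ` A' \<subseteq> B \<and>
     (\<forall>a\<in>A'. a \<otimes>\<^bsub>G\<^esub> f a \<notin> A)"

end

theory Submission
  imports Defs
begin

text \<open>
  A matching of defect \<open>d\<close> exists iff Hall's condition with deficiency \<open>d\<close> holds for the bipartite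
  graph joining \<open>a\<close> to \<open>b\<close> when \<open>ab \<notin> A\<close>. A set \<open>S\<close> violates Hall's condition iff
  \<open>|S| + |T| > |B| + d + 1\<close> for the set \<open>T\<close> of all \<open>b \<in> B \<union> {1}\<close> with \<open>Sb \<subseteq> A\<close>. As long as \<open>ST \<noteq> S\<close>,
  the Dyson transform replaces \<open>(S, T)\<close> by \<open>(S \<union> sT, T \<inter> s\<^sup>-\<^sup>1S)\<close>, preserving \<open>|S| + |T|\<close> and keeping
  the product set inside \<open>A\<close>, while \<open>T\<close> shrinks. It therefore ends at a violating pair with \<open>ST = S\<close>.
\<close>

text \<open>Induction on \<open>card I\<close>. If a nonempty proper \<open>J\<close> is tight,
  \<open>J\<close> and \<open>I - J\<close> are matched separately, the latter outside the
  neighbours of \<open>J\<close>. Otherwise every nonempty proper subset has a spare neighbour, so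
  any single edge can be fixed and its ends removed.\<close>

lemma hall_marriage:
  fixes N :: "'i \<Rightarrow> 'b set"
  assumes "finite I"
    and "\<And>i. i \<in> I \<Longrightarrow> finite (N i)"
    and "\<And>J. J \<subseteq> I \<Longrightarrow> card J \<le> card (\<Union>(N ` J))"
  shows "\<exists>f. inj_on f I \<and> (\<forall>i\<in>I. f i \<in> N i)"
  using assms
proof (induction "card I" arbitrary: I N rule: less_induct)
  case less
  note fin = less.prems(1) and finN = less.prems(2) and hall = less.prems(3)
  have finU: "finite (\<Union>(N ` J))" if "J \<subseteq> I" for J
    using that fin finN by (meson finite_UN_I finite_subset subsetD)
  consider (empty) "I = {}"
    | (tight) J where "J \<subset> I" "J \<noteq> {}" "card J = card (\<Union>(N ` J))"
    | (loose) "I \<noteq> {}" "\<And>J. J \<subset> I \<Longrightarrow> J \<noteq> {} \<Longrightarrow> card J < card (\<Union>(N ` J))"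
    using hall by (metis order_le_less psubset_imp_subset)
  then show ?case
  proof cases
    case empty
    then show ?thesis by simp
  next
    case tight
    define U where "U = \<Union>(N ` J)"
    have JI: "J \<subseteq> I" using tight(1) by auto
    have finJ: "finite J" using JI fin finite_subset by blast
    have "card J < card I" using tight(1) fin by (simp add: psubset_card_mono)
    then obtain f where f: "inj_on f J" "\<forall>i\<in>J. f i \<in> N i"
      using less.hyps[of J N] finJ finN hall JI by (metis subsetD subset_trans)
    have "card (I - J) < card I"
      using tight(1,2) fin by (intro psubset_card_mono) auto
    \<comment> \<open>Hall's condition survives outside \<open>U\<close>: apply it to
      \<open>K \<union> J\<close> and cancel \<open>card J = card U\<close>.\<close>
    moreover have "card K \<le> card (\<Union>((\<lambda>i. N i - U) ` K))" if K: "K \<subseteq> I - J" for K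
    proof -
      have finK: "finite K" using K fin by (meson finite_Diff finite_subset)
      have sub: "K \<union> J \<subseteq> I" using K JI by auto
      have "card K + card J = card (K \<union> J)"
        using K finK finJ by (subst card_Un_disjoint) auto
      also have "\<dots> \<le> card (\<Union>(N ` (K \<union> J)))" using hall[OF sub] .
      also have "\<Union>(N ` (K \<union> J)) = \<Union>((\<lambda>i. N i - U) ` K) \<union> U"
        unfolding U_def by auto
      also have "card \<dots> \<le> card (\<Union>((\<lambda>i. N i - U) ` K)) + card U"
        by (rule card_Un_le)
      finally show ?thesis using tight(3) U_def by simp
    qed
    ultimately obtain g where g: "inj_on g (I - J)" "\<forall>i\<in>I - J. g i \<in> N i - U"
      using less.hyps[of "I - J" "\<lambda>i. N i - U"] fin finN by auto
    let ?h = "\<lambda>i. if i \<in> J then f i else g i"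
    have fU: "f i \<in> U" if "i \<in> J" for i using that f(2) U_def by auto
    have "inj_on ?h I"
    proof (rule inj_onI)
      fix x y assume xy: "x \<in> I" "y \<in> I" "?h x = ?h y"
      then have "x \<in> J \<longleftrightarrow> y \<in> J"
        using fU g(2) by (metis Diff_iff)
      then show "x = y"
        using xy f(1) g(1) by (auto split: if_splits dest: inj_onD)
    qed
    moreover have "\<forall>i\<in>I. ?h i \<in> N i" using f(2) g(2) by auto
    ultimately show ?thesis by blast
  next
    case loose
    then obtain i where i: "i \<in> I" by auto
    have "card {i} \<le> card (\<Union>(N ` {i}))" using hall[of "{i}"] i by blast
    then obtain x where x: "x \<in> N i" by fastforce
    have "card (I - {i}) < card I" using i fin by (meson card_Diff1_less)
    \<comment> \<open>Deleting \<open>x\<close> costs at most one neighbour, which the strict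
      inequality absorbs.\<close>
    moreover have "card K \<le> card (\<Union>((\<lambda>j. N j - {x}) ` K))" if K: "K \<subseteq> I - {i}" for K
    proof (cases "K = {}")
      case False
      then have "card K < card (\<Union>(N ` K))" using loose(2)[of K] K i by blast
      moreover have "\<Union>((\<lambda>j. N j - {x}) ` K) = \<Union>(N ` K) - {x}" by auto
      ultimately show ?thesis by (auto simp: card_Diff_singleton_if)
    qed simp
    ultimately obtain g where g: "inj_on g (I - {i})" "\<forall>j\<in>I - {i}. g j \<in> N j - {x}"
      using less.hyps[of "I - {i}" "\<lambda>j. N j - {x}"] fin finN by auto
    have "inj_on (g(i := x)) (insert i (I - {i}))"
      using g by (auto simp: inj_on_def)
    moreover have "\<forall>j\<in>I. (g(i := x)) j \<in> N j" using g(2) x by auto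
    ultimately show ?thesis using i by (metis insert_Diff)
  qed
qed

text \<open>Hall's theorem is applied after adding \<open>d\<close> dummy elements to every neighbourhood.\<close>

lemma hall_marriage_deficiency:
  fixes N :: "'i \<Rightarrow> 'b set"
  assumes "finite I" and "d \<le> card I"
    and finN: "\<And>i. i \<in> I \<Longrightarrow> finite (N i)"
    and hall: "\<And>J. J \<subseteq> I \<Longrightarrow> card J \<le> card (\<Union>(N ` J)) + d"
  shows "\<exists>I' f. I' \<subseteq> I \<and> card (I - I') = d \<and> inj_on f I' \<and> (\<forall>i\<in>I'. f i \<in> N i)"
proof -
  define M :: "'i \<Rightarrow> ('b + nat) set" where "M i = Inl ` N i \<union> Inr ` {..<d}" for i
  have "card J \<le> card (\<Union>(M ` J))" if J: "J \<subseteq> I" for J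
  \<comment> \<open>The dummies lie in the union only when \<open>J\<close> is nonempty.\<close>
  proof (cases "J = {}")
    case False
    have fin: "finite (\<Union>(N ` J))"
      using J \<open>finite I\<close> finN by (meson finite_UN_I finite_subset subsetD)
    have "\<Union>(M ` J) = Inl ` \<Union>(N ` J) \<union> Inr ` {..<d}"
      using False unfolding M_def by auto
    then have "card (\<Union>(M ` J)) = card (Inl ` \<Union>(N ` J) :: ('b + nat) set)
        + card (Inr ` {..<d} :: ('b + nat) set)"
      using fin by (simp only:) (rule card_Un_disjoint; auto)
    also have "\<dots> = card (\<Union>(N ` J)) + d" by (simp add: card_image)
    finally show ?thesis using hall[OF J] by simp
  qed simp
  moreover have "finite (M i)" if "i \<in> I" for i using that finN unfolding M_def by simp
  ultimately obtain g where g: "inj_on g I" "\<forall>i\<in>I. g i \<in> M i"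
    using hall_marriage[of I M] \<open>finite I\<close> by blast
  \<comment> \<open>\<open>D\<close> collects the indices matched to dummies, at most
    \<open>d\<close> of them. The defect must be exactly \<open>d\<close>, so \<open>D\<close> is
    enlarged to a set \<open>E\<close> of that size and all of \<open>E\<close> is left
    unmatched.\<close>
  define D where "D = {i \<in> I. g i \<in> Inr ` {..<d}}"
  have "D \<subseteq> I" unfolding D_def by auto
  have "card D \<le> card (Inr ` {..<d} :: ('b + nat) set)"
    using g(1) by (intro card_inj_on_le[of g]) (auto simp: D_def inj_on_def)
  then have "card D \<le> d" by (simp add: card_image)
  then obtain E where E: "D \<subseteq> E" "E \<subseteq> I" "card E = d"
    using exists_subset_between[of D d I] \<open>D \<subseteq> I\<close> assms(1,2) by blast
  have Inl: "\<exists>b \<in> N i. g i = Inl b" if "i \<in> I - E" for i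
    using that g(2) E(1) unfolding M_def D_def by fastforce
  have "inj_on (projl \<circ> g) (I - E)"
  proof (rule inj_onI)
    fix x y assume xy: "x \<in> I - E" "y \<in> I - E" "(projl \<circ> g) x = (projl \<circ> g) y"
    then have "g x = g y" using Inl[of x] Inl[of y] by auto
    then show "x = y" using xy g(1) by (auto dest: inj_onD)
  qed
  moreover have "\<forall>i\<in>I - E. (projl \<circ> g) i \<in> N i" using Inl by fastforce
  moreover have "I - (I - E) = E" using E(2) by auto
  ultimately show ?thesis using E(3) by (metis Diff_subset)
qed

lemma (in comm_group) dyson_transform_stable_pair:
  assumes "finite S" "finite T" "S \<subseteq> carrier G" "T \<subseteq> carrier G" "\<one> \<in> T"
  shows "\<exists>S' T'. S' \<subseteq> S <#> T \<and> T' \<subseteq> T \<and> S' <#> T' = S' \<and>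
    card S + card T \<le> card S' + card T'"
  using assms
proof (induction "card T" arbitrary: S T rule: less_induct)
  case less
  note fS = less.prems(1) and fT = less.prems(2) and SG = less.prems(3)
    and TG = less.prems(4) and one = less.prems(5)
  show ?case
  proof (cases "S <#> T = S")
    case True
    then show ?thesis by blast
  next
    case False
    \<comment> \<open>Since \<open>S\<close> lies in its product with \<open>T\<close>, the two can
      differ only by some \<open>s \<otimes> t\<close> outside \<open>S\<close>. This
      \<open>s\<close> drives the transform, and this \<open>t\<close> drops out of
      \<open>T1\<close>, so the induction descends.\<close>
    have "S \<subseteq> S <#> T"
      using SG one unfolding set_mult_def by (force intro: r_one[symmetric])
    then obtain s t where st: "s \<in> S" "t \<in> T" "s \<otimes> t \<notin> S"
      using False unfolding set_mult_def by blast
    have sG: "s \<in> carrier G" using st SG by blast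
    let ?m = "\<lambda>x. s \<otimes> x"
    define S1 where "S1 = S \<union> ?m ` T"
    define T1 where "T1 = {x \<in> T. s \<otimes> x \<in> S}"
    have inj: "inj_on ?m T" using sG TG by (auto simp: inj_on_def subset_iff)
    have "?m ` T1 = S \<inter> ?m ` T" unfolding T1_def by auto
    then have "card T1 = card (S \<inter> ?m ` T)"
      using inj by (metis (no_types, lifting) T1_def card_image inj_on_subset mem_Collect_eq subsetI)
    then have sum: "card S + card T = card S1 + card T1"
      using card_Un_Int[of S "?m ` T"] fS fT inj unfolding S1_def by (simp add: card_image)
    have "card T1 < card T"
      using st fT by (intro psubset_card_mono) (auto simp: T1_def)
    moreover have "finite S1" "finite T1" "S1 \<subseteq> carrier G" "T1 \<subseteq> carrier G" "\<one> \<in> T1"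
      using fS fT SG TG sG one st(1) unfolding S1_def T1_def by auto
    ultimately obtain S' T' where IH: "S' \<subseteq> S1 <#> T1" "T' \<subseteq> T1" "S' <#> T' = S'"
      "card S1 + card T1 \<le> card S' + card T'"
      using less.hyps[of T1 S1] by blast
    \<comment> \<open>For a new element \<open>s \<otimes> u\<close> and \<open>y\<close> in
      \<open>T1\<close>, commutativity gives
      \<open>(s \<otimes> u) \<otimes> y = (s \<otimes> y) \<otimes> u\<close>, where
      \<open>s \<otimes> y\<close> lies in \<open>S\<close> by the choice of
      \<open>T1\<close>.\<close>
    have "S1 <#> T1 \<subseteq> S <#> T"
    proof
      fix z assume "z \<in> S1 <#> T1"
      then obtain x y where xy: "x \<in> S1" "y \<in> T1" "z = x \<otimes> y"
        unfolding set_mult_def by blast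
      show "z \<in> S <#> T"
      proof (cases "x \<in> S")
        case True
        then show ?thesis using xy unfolding T1_def set_mult_def by blast
      next
        case False
        then obtain u where u: "u \<in> T" "x = s \<otimes> u" using xy(1) unfolding S1_def by blast
        have "u \<in> carrier G" "y \<in> carrier G" using u xy TG unfolding T1_def by auto
        then have "z = (s \<otimes> y) \<otimes> u" using sG xy(3) u(2) by (simp add: m_ac)
        then show ?thesis using u(1) xy(2) unfolding T1_def set_mult_def by blast
      qed
    qed
    moreover have "T1 \<subseteq> T" unfolding T1_def by auto
    ultimately show ?thesis using IH sum by (metis subset_trans)
  qed
qed

theorem theorem3p3:
  fixes G :: "('a, 'b) monoid_scheme" and A B :: "'a set" and d :: nat
  assumes "comm_group G"
    and "A \<subseteq> carrier G" and "finite A" and "A \<noteq> {}"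
    and "B \<subseteq> carrier G" and "finite B" and "B \<noteq> {}"
    and "card A = card B"
    and "\<one>\<^bsub>G\<^esub> \<notin> B"
    and "d \<le> card A"
  shows "(\<exists>A' f. partial_matching G A B d A' f) \<longleftrightarrow>
    (\<forall>S R. S \<subseteq> A \<longrightarrow> R \<subseteq> B \<union> {\<one>\<^bsub>G\<^esub>} \<longrightarrow> S <#>\<^bsub>G\<^esub> R = S \<longrightarrow>
       int (card S) - int d \<le> int (card (B - R)))"
proof -
  interpret comm_group G by fact
  show ?thesis
  proof (intro iffI allI impI)
    fix S R
    assume "\<exists>A' f. partial_matching G A B d A' f"
      and S: "S \<subseteq> A" and SR: "S <#>\<^bsub>G\<^esub> R = S"
    then obtain A' f where f: "A' \<subseteq> A" "card (A - A') = d" "inj_on f A'" "f ` A' \<subseteq> B"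
      "\<forall>a\<in>A'. a \<otimes>\<^bsub>G\<^esub> f a \<notin> A"
      unfolding partial_matching_def by blast
    have finS: "finite S" using S \<open>finite A\<close> finite_subset by blast
    \<comment> \<open>A value \<open>f a\<close> in \<open>R\<close> would put the product of
      \<open>a\<close> and \<open>f a\<close> into \<open>S\<close>, hence into \<open>A\<close>. So
      the matched part of \<open>S\<close> injects into \<open>B - R\<close>, and at most
      \<open>d\<close> elements of \<open>S\<close> are unmatched.\<close>
    have "f ` (S \<inter> A') \<subseteq> B - R"
    proof
      fix y assume "y \<in> f ` (S \<inter> A')"
      then obtain a where a: "a \<in> S" "a \<in> A'" "y = f a" by blast
      have "f a \<notin> R"
      proof
        assume "f a \<in> R"
        then have "a \<otimes>\<^bsub>G\<^esub> f a \<in> S" using a(1) SR unfolding set_mult_def by blast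
        then show False using f(5) a(2) S by blast
      qed
      then show "y \<in> B - R" using a f(4) by blast
    qed
    then have "card (S \<inter> A') \<le> card (B - R)"
      using \<open>finite B\<close> f(3) by (meson card_inj_on_le finite_Diff inf_le2 inj_on_subset)
    moreover have "card S = card (S \<inter> A') + card (S - A')"
      using finS by (metis Int_Diff_disjoint Int_Diff_Un card_Un_disjoint finite_Diff finite_Int)
    moreover have "card (S - A') \<le> d"
      unfolding f(2)[symmetric] using S \<open>finite A\<close> by (intro card_mono) auto
    ultimately show "int (card S) - int d \<le> int (card (B - R))" by linarith
  next
    assume cond: "\<forall>S R. S \<subseteq> A \<longrightarrow> R \<subseteq> B \<union> {\<one>\<^bsub>G\<^esub>} \<longrightarrow> S <#>\<^bsub>G\<^esub> R = S \<longrightarrow>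
       int (card S) - int d \<le> int (card (B - R))"
    define N where "N a = {b \<in> B. a \<otimes>\<^bsub>G\<^esub> b \<notin> A}" for a
    have "card S \<le> card (\<Union>(N ` S)) + d" if S: "S \<subseteq> A" for S
    proof -
      \<comment> \<open>\<open>R\<close> consists of the \<open>b\<close> in \<open>B\<close> that
        send all of \<open>S\<close> into \<open>A\<close>. Adding the identity keeps the products
        in \<open>A\<close> because \<open>S \<subseteq> A\<close>, and it raises the cardinality by
        one because the identity is not in \<open>B\<close>.\<close>
      define R where "R = B - \<Union>(N ` S)"
      define T where "T = insert \<one>\<^bsub>G\<^esub> R"
      have sub: "\<Union>(N ` S) \<subseteq> B" unfolding N_def by auto
      have finR: "finite R" using \<open>finite B\<close> unfolding R_def by simp
      have cT: "card T = Suc (card R)"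
        using finR \<open>\<one>\<^bsub>G\<^esub> \<notin> B\<close> unfolding T_def R_def by simp
      have cR: "card R + card (\<Union>(N ` S)) = card B"
        using sub \<open>finite B\<close> unfolding R_def
        by (metis card_Diff_subset card_mono finite_subset le_add_diff_inverse2)
      have STA: "S <#>\<^bsub>G\<^esub> T \<subseteq> A"
        using S \<open>A \<subseteq> carrier G\<close> unfolding set_mult_def T_def R_def N_def by (auto simp: subset_iff)
      have TB: "T \<subseteq> B \<union> {\<one>\<^bsub>G\<^esub>}" unfolding T_def R_def by auto
      have "finite S" "finite T" "S \<subseteq> carrier G" "T \<subseteq> carrier G" "\<one>\<^bsub>G\<^esub> \<in> T"
        using S assms(2,3,5) finR finite_subset unfolding T_def R_def by auto
      then obtain S' T' where ST': "S' \<subseteq> S <#>\<^bsub>G\<^esub> T" "T' \<subseteq> T" "S' <#>\<^bsub>G\<^esub> T' = S'"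
        "card S + card T \<le> card S' + card T'"
        using dyson_transform_stable_pair[of S T] by blast
      have "int (card S') - int d \<le> int (card (B - T'))"
        using cond ST' STA TB by (meson subset_trans)
      \<comment> \<open>Both sets are disjoint parts of \<open>B\<close> with the identity added.
        The extra one on the right cancels the one in \<open>cT\<close>, which leaves exactly Hall's
        condition with deficiency \<open>d\<close>.\<close>
      moreover have "card (B - T') + card T' \<le> Suc (card B)"
      proof -
        have "finite T'" using ST'(2) \<open>finite T\<close> finite_subset by blast
        then have "card (B - T') + card T' = card ((B - T') \<union> T')"
          using \<open>finite B\<close> by (subst card_Un_disjoint) auto
        also have "\<dots> \<le> card (insert \<one>\<^bsub>G\<^esub> B)"
          using ST'(2) TB \<open>finite B\<close> by (intro card_mono) auto
        also have "\<dots> \<le> Suc (card B)" by (simp add: card_insert_if \<open>finite B\<close>)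
        finally show ?thesis .
      qed
      ultimately show ?thesis using ST'(4) cT cR by linarith
    qed
    moreover have "finite (N a)" for a using \<open>finite B\<close> unfolding N_def by simp
    ultimately obtain A' f where "A' \<subseteq> A" "card (A - A') = d" "inj_on f A'" "\<forall>a\<in>A'. f a \<in> N a"
      using hall_marriage_deficiency[of A d N] \<open>finite A\<close> \<open>d \<le> card A\<close> by blast
    then have "partial_matching G A B d A' f"
      unfolding partial_matching_def N_def by blast
    then show "\<exists>A' f. partial_matching G A B d A' f" by blast
  qed
qed

end
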